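(* Let $m > k > 0$ be positive integers, let $n$ be a positive integer, and let $A$ and $B$ be $n \times n$ positive semidefinite matrices of norm $1$ such that the pair $(A,B)$ minimizes (resp. maximizes) the quantity $\mathrm{Tr}[S_{m,k}(X,Y)]$ over all pairs $(X,Y)$ of $n\times n$ positive semidefinite matrices of norm $1$. Then $A$ and $B$ satisfy the following pair of equations: $$A\,S_{m-1,k}(A,B) = \mathrm{Tr}[A\,S_{m-1,k}(A,B)]\; A^2,$$ $$B\,S_{m-1,k-1}(A,B) = \mathrm{Tr}[B\,S_{m-1,k-1}(A,B)]\; B^2.$$
   Context: Matrices are complex. A positive semidefinite matrix is a complex Hermitian matrix all of whose eigenvalues are nonnegative. For a complex matrix $C$, $C^*$ denotes the conjugate transpose, and the norm is $\|C\| = \mathrm{Tr}[CC^*]^{1/2}$. For $n\times n$ matrices $A,B$ and integers $m\ge 0$, $0\le k\le m$, $S_{m,k}(A,B)$ denotes the sum of all words of length $m$ in $A$ and $B$ in which exactly $k$ $B$'s appear, i.e. the (matrix) coefficient of $t^k$ in $(A+tB)^m$ (so $S_{0,0}(A,B)=I$). When $A,B$ are Hermitian, $\mathrm{Tr}[S_{m,k}(A,B)]$ is real. *)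

theory Defs
  imports "HOL-Analysis.Analysis"
begin

definition conj_transpose :: "complex^'n^'m \<Rightarrow> complex^'m^'n" where
  "conj_transpose C = (\<chi> i j. cnj (C $ j $ i))"

definition hermitian :: "complex^'n^'n \<Rightarrow> bool" where
  "hermitian A \<longleftrightarrow> conj_transpose A = A"

definition eigenvalue :: "complex^'n^'n \<Rightarrow> complex \<Rightarrow> bool" where
  "eigenvalue A c \<longleftrightarrow> (\<exists>v. v \<noteq> 0 \<and> A *v v = c *s v)"

definition pos_semidef :: "complex^'n^'n \<Rightarrow> bool" where
  "pos_semidef A \<longleftrightarrow> hermitian A \<and> (\<forall>c. eigenvalue A c \<longrightarrow> c \<in> \<real>\<^sub>\<ge>\<^sub>0)"

(* Tr[C C^*] is always a nonnegative real number, so taking its real part loses nothing. *)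
definition mat_norm :: "complex^'n^'n \<Rightarrow> real" where
  "mat_norm C = sqrt (Re (trace (C ** conj_transpose C)))"

(* The matrix types carry no scalar multiplication by complex numbers in the library:
   *s acts on vectors, and *\<^sub>R takes real scalars only. *)
definition mat_scale :: "complex \<Rightarrow> complex^'n^'n \<Rightarrow> complex^'n^'n" where
  "mat_scale c M = (\<chi> i j. c * M $ i $ j)"

(* A word is a list over the two formal letters False (standing for A) and True
   (standing for B), so distinct words stay distinct summands in S even when their
   values coincide. The empty word has value the identity matrix. *)
definition word_val :: "complex^'n^'n \<Rightarrow> complex^'n^'n \<Rightarrow> bool list \<Rightarrow> complex^'n^'n" where
  "word_val A B w = foldr (\<lambda>b M. (if b then B else A) ** M) w (mat 1)"

definition S :: "nat \<Rightarrow> nat \<Rightarrow> complex^'n^'n \<Rightarrow> complex^'n^'n \<Rightarrow> complex^'n^'n" where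
  "S m k A B = (\<Sum>w | length w = m \<and> count_list w True = k. word_val A B w)"

definition feasible :: "(complex^'n^'n) \<times> (complex^'n^'n) \<Rightarrow> bool" where
  "feasible = (\<lambda>(X, Y). pos_semidef X \<and> mat_norm X = 1 \<and> pos_semidef Y \<and> mat_norm Y = 1)"

(* On pairs of Hermitian matrices Tr[S m k X Y] is real, hence equal to this real part. *)
definition trace_S :: "nat \<Rightarrow> nat \<Rightarrow> (complex^'n^'n) \<times> (complex^'n^'n) \<Rightarrow> real" where
  "trace_S m k = (\<lambda>(X, Y). Re (trace (S m k X Y)))"

end

theory Submission
  imports Defs
begin

text \<open>
  Write $f(X) = \mathrm{Re}\,\mathrm{Tr}\,S_{m,k}(X,B)$ and let $A$ be an extremal point of $f$
  among the positive semidefinite matrices of norm $1$. The variations used are congruences: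
  $A_t = (1 + tH) A (1 + tH)^*$ is positive semidefinite for every real $t$ and every matrix $H$,
  so no inequality has to be imposed on the direction. The norm constraint disappears
  because $f$ is homogeneous of degree $m - k$: at a minimum
  $f(A_t) \ge f(A)\,\|A_t\|^{m-k}$ for all $t$ (with the reverse inequality at a maximum), with
  equality at $t = 0$, so the two sides have equal derivatives there.

  The derivative of $f$ in a direction $D$ is $m\,\mathrm{Re}\,\mathrm{Tr}(D\,S_{m-1,k}(A,B))$.
  This comes from the generating function $(A + sB)^m = \sum_k s^k S_{m,k}(A,B)$: the cyclicity
  of the trace gives the derivative of $\mathrm{Tr}\,(A + sB)^m$ in $A$, and coefficients
  of powers of $s$ are compared. The derivative of the norm is $\langle A, D\rangle$. With
  $W = S_{m-1,k}(A,B) - cA$ and $c = (m-k) f(A) / m$, stationarity says that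
  $\langle D, W\rangle = 0$ for $D = HA + AH^*$. Since $A$ and $W$ are Hermitian, this means
  $\langle H, WA\rangle = 0$, and the choice $H = WA$ yields $WA = 0$, hence $AW = 0$, that is
  $A\,S_{m-1,k}(A,B) = cA^2$. Taking traces and using $\mathrm{Tr}\,A^2 = 1$ identifies $c$.
  The equation for $B$ is the same statement with the two letters exchanged, because
  $S_{m,k}(A,B) = S_{m,m-k}(B,A)$.

  Positive semidefiniteness is given by eigenvalues, whereas invariance under congruence is
  visible on the quadratic form. The bridge is the minimum of the Rayleigh quotient, which is
  an eigenvalue.
\<close>

section \<open>Complex matrices as a real inner product space\<close>

lemma bounded_bilinear_matrix_mult:
  "bounded_bilinear ((**) :: complex^'n^'n \<Rightarrow> complex^'n^'n \<Rightarrow> complex^'n^'n)"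
  unfolding bilinear_conv_bounded_bilinear[symmetric] bilinear_def
  by (auto intro!: linearI simp: matrix_matrix_mult_def vec_eq_iff sum.distrib sum_distrib_left
      scaleR_sum_right algebra_simps)

interpretation matmul: bounded_bilinear
  "(**) :: complex^'n^'n \<Rightarrow> complex^'n^'n \<Rightarrow> complex^'n^'n"
  by (rule bounded_bilinear_matrix_mult)

lemma linear_conj_transpose: "linear (conj_transpose :: complex^'n^'n \<Rightarrow> complex^'n^'n)"
  by (auto intro!: linearI simp: conj_transpose_def vec_eq_iff)

lemmas conj_transpose_linear_simps =
  linear_add[OF linear_conj_transpose] linear_diff[OF linear_conj_transpose]
  linear_scale[OF linear_conj_transpose] linear_sum[OF linear_conj_transpose]
  linear_0[OF linear_conj_transpose]

lemma conj_transpose_conj_transpose [simp]: "conj_transpose (conj_transpose M) = M"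
  by (simp add: conj_transpose_def vec_eq_iff)

lemma conj_transpose_mult: "conj_transpose (M ** N) = conj_transpose N ** conj_transpose M"
  by (simp add: conj_transpose_def vec_eq_iff matrix_matrix_mult_def mult.commute)

lemma conj_transpose_mat_1 [simp]: "conj_transpose (mat 1 :: complex^'n^'n) = mat 1"
  by (auto simp: conj_transpose_def vec_eq_iff mat_def)

lemma bounded_linear_Re_trace: "bounded_linear (\<lambda>M :: complex^'n^'n. Re (trace M))"
  unfolding linear_conv_bounded_linear[symmetric]
  by (auto intro!: linearI simp: trace_def sum.distrib sum_distrib_left)

lemmas Re_trace_linear_simps =
  linear_add[OF bounded_linear.linear[OF bounded_linear_Re_trace]]
  linear_scale[OF bounded_linear.linear[OF bounded_linear_Re_trace]]
  linear_sum[OF bounded_linear.linear[OF bounded_linear_Re_trace]]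

text \<open>The real inner product carried by the type of matrices is the real part of the
  Frobenius product, so the norm of the type is the Frobenius norm.\<close>

lemma inner_matrix_eq_trace:
  fixes M N :: "complex^'n^'n"
  shows "inner M N = Re (trace (M ** conj_transpose N))"
  by (simp add: inner_vec_def trace_def matrix_matrix_mult_def conj_transpose_def
      inner_complex_def)

lemma mat_norm_eq_norm: "mat_norm M = norm M"
  by (simp add: mat_norm_def norm_eq_sqrt_inner inner_matrix_eq_trace)

lemma inner_conj_transpose:
  fixes M N :: "complex^'n^'n"
  shows "inner (conj_transpose M) (conj_transpose N) = inner M N"
  by (simp add: inner_vec_def conj_transpose_def inner_complex_def) (rule sum.swap)

lemma inner_mult_left_matrix:
  fixes M N P :: "complex^'n^'n"
  shows "inner (M ** N) P = inner M (P ** conj_transpose N)"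
  by (simp add: inner_matrix_eq_trace conj_transpose_mult matrix_mul_assoc)

lemma inner_matrix_vector:
  fixes M :: "complex^'n^'n"
  shows "inner (M *v x) y = inner x (conj_transpose M *v y)"
proof -
  have "inner (M *v x) y = (\<Sum>i\<in>UNIV. \<Sum>j\<in>UNIV. Re (M $ i $ j * x $ j * cnj (y $ i)))"
    by (simp add: inner_vec_def matrix_vector_mult_def inner_complex_def sum_distrib_right
        flip: sum.distrib)
  also have "\<dots> = (\<Sum>j\<in>UNIV. \<Sum>i\<in>UNIV. Re (M $ i $ j * x $ j * cnj (y $ i)))"
    by (rule sum.swap)
  also have "\<dots> = inner x (conj_transpose M *v y)"
    by (simp add: inner_vec_def matrix_vector_mult_def inner_complex_def sum_distrib_left
        conj_transpose_def algebra_simps flip: sum.distrib)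
  finally show ?thesis .
qed

lemma inner_scale_complex:
  fixes v w :: "complex^'n"
  shows "inner (c *s v) (d *s v) = Re (c * cnj d) * inner v v"
  by (simp add: inner_vec_def inner_complex_def sum_distrib_left algebra_simps)

lemma scaleR_matrix_mult_vector:
  fixes M :: "complex^'n^'n"
  shows "(r *\<^sub>R M) *v x = r *\<^sub>R (M *v x)"
  by (simp add: matrix_vector_mult_def vec_eq_iff scaleR_sum_right)

lemma matrix_mult_vector_scaleR:
  fixes M :: "complex^'n^'n"
  shows "M *v (r *\<^sub>R x) = r *\<^sub>R (M *v x)"
  by (simp add: linear_scale)

section \<open>Positive semidefiniteness through the quadratic form\<close>

text \<open>At a zero $u$ of a nonnegative quadratic form the linear term of
  $q(u + tw)$ in $t$ must vanish for every $w$; the direction $w = Mu$ turns that term into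
  $2t\,\|Mu\|^2$.\<close>

lemma quadratic_form_kernel:
  fixes M :: "complex^'n^'n"
  assumes herm: "hermitian M" and nonneg: "\<And>v. 0 \<le> inner v (M *v v)"
    and zero: "inner u (M *v u) = 0"
  shows "M *v u = 0"
proof -
  define w where "w = M *v u"
  have "inner u (M *v w) = inner w w"
    using inner_matrix_vector[of M u w] herm by (simp add: w_def hermitian_def)
  moreover have "0 \<le> inner (u + t *\<^sub>R w) (M *v (u + t *\<^sub>R w))" for t
    by (rule nonneg)
  ultimately have q: "0 \<le> 2 * t * inner w w + t\<^sup>2 * inner w (M *v w)" for t
    using zero by (simp add: matrix_vector_right_distrib matrix_mult_vector_scaleR inner_add_left
        inner_add_right w_def[symmetric] power2_eq_square algebra_simps)
  have "((\<lambda>t. 2 * t * inner w w + t\<^sup>2 * inner w (M *v w)) has_real_derivative 2 * inner w w) (at 0)"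
    by (auto intro!: derivative_eq_intros)
  from DERIV_local_min[OF this zero_less_one] q have "2 * inner w w = 0" by simp
  then show ?thesis by (simp add: w_def)
qed

text \<open>The minimum $l$ of the quadratic form on the unit sphere exists by
  compactness; $M - l$ then has a nonnegative form that vanishes at the minimizer, which
  therefore lies in its kernel.\<close>

lemma hermitian_min_eigenvalue:
  fixes M :: "complex^'n^'n"
  assumes herm: "hermitian M"
  obtains l :: real where "eigenvalue M (of_real l)" "\<And>v. l * inner v v \<le> inner v (M *v v)"
proof -
  have "continuous_on (sphere 0 1) (\<lambda>v. inner v (M *v v))"
    by (intro continuous_intros bounded_linear.continuous_on[OF matrix_vector_mul_bounded_linear])
  moreover have "sphere (0 :: complex^'n) 1 \<noteq> {}" by simp
  ultimately obtain u where u: "norm u = 1"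
    and umin: "\<And>v. norm v = 1 \<Longrightarrow> inner u (M *v u) \<le> inner v (M *v v)"
    using continuous_attains_inf[of "sphere 0 1" "\<lambda>v. inner v (M *v v)"] by auto
  define l where "l = inner u (M *v u)"
  have bound: "l * inner v v \<le> inner v (M *v v)" for v
  proof (cases "v = 0")
    case False
    have "l \<le> inner (v /\<^sub>R norm v) (M *v (v /\<^sub>R norm v))"
      unfolding l_def using False by (intro umin) simp
    also have "\<dots> = inner v (M *v v) / inner v v"
      by (simp add: matrix_mult_vector_scaleR divide_inverse norm_eq_sqrt_inner power_inverse
          flip: power2_eq_square mult.assoc)
    finally show ?thesis using False by (simp add: pos_le_divide_eq)
  qed simp
  define N where "N = M - l *\<^sub>R mat 1"
  have N: "N *v v = M *v v - l *\<^sub>R v" for v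
    by (simp add: N_def matrix_vector_mult_diff_rdistrib scaleR_matrix_mult_vector)
  have "N *v u = 0"
  proof (rule quadratic_form_kernel)
    show "hermitian N"
      using herm by (simp add: N_def hermitian_def conj_transpose_linear_simps)
    show "0 \<le> inner v (N *v v)" for v
      using bound[of v] by (simp add: N inner_diff_right)
    show "inner u (N *v u) = 0"
      using u by (simp add: N inner_diff_right l_def power2_norm_eq_inner[symmetric])
  qed
  then have "M *v u = of_real l *s u"
    by (simp add: N vec_eq_iff scaleR_conv_of_real[symmetric])
  moreover have "u \<noteq> 0" using u by auto
  ultimately have "eigenvalue M (of_real l)" unfolding eigenvalue_def by blast
  from this bound show thesis by (rule that)
qed

text \<open>From eigenvalues to the form, the lower bound by the smallest eigenvalue
  suffices. Conversely, an eigenvalue $c$ with eigenvector $v$ is nonnegative in its real part by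
  evaluating the form at $v$, and is real because $M$ is self-adjoint.\<close>

lemma pos_semidef_iff_quadratic_form:
  fixes M :: "complex^'n^'n"
  shows "pos_semidef M \<longleftrightarrow> hermitian M \<and> (\<forall>v. 0 \<le> inner v (M *v v))"
proof (intro iffI conjI allI)
  assume M: "pos_semidef M"
  then show herm: "hermitian M" by (simp add: pos_semidef_def)
  fix v
  obtain l where l: "eigenvalue M (of_real l)" "\<And>v. l * inner v v \<le> inner v (M *v v)"
    using hermitian_min_eigenvalue[OF herm] by blast
  with M have "l \<ge> 0" by (auto simp: pos_semidef_def)
  then show "0 \<le> inner v (M *v v)"
    using l(2)[of v] by (meson inner_ge_zero mult_nonneg_nonneg order_trans)
next
  assume M: "hermitian M \<and> (\<forall>v. 0 \<le> inner v (M *v v))"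
  show "pos_semidef M" unfolding pos_semidef_def
  proof (intro conjI allI impI)
    show "hermitian M" using M by simp
    fix c assume "eigenvalue M c"
    then obtain v where v: "v \<noteq> 0" "M *v v = c *s v" by (auto simp: eigenvalue_def)
    then have pos: "inner v v > 0" by simp
    have "0 \<le> inner (1 *s v) (c *s v)" using M v(2) by (metis vector_smult_lid)
    then have "0 \<le> Re c * inner v v" by (simp only: inner_scale_complex) simp
    then have "0 \<le> Re c" using pos by (simp add: zero_le_mult_iff)
    \<comment> \<open>The inner product only sees real parts; pairing $\mathrm{i}v$ with $Mv$ brings out the
      imaginary part of $c$, with opposite signs on the two sides of the adjoint identity.\<close>
    moreover have "inner (\<i> *s v) (c *s v) = inner ((\<i> * c) *s v) (1 *s v)"
    proof -
      have "M *v (\<i> *s v) = (\<i> * c) *s v"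
        by (simp add: vector_scalar_commute v(2) vector_smult_assoc)
      then show ?thesis
        using inner_matrix_vector[of M "\<i> *s v" v] M v(2)
        by (simp add: hermitian_def)
    qed
    then have "Im c = 0" using pos by (simp only: inner_scale_complex) simp
    ultimately show "c \<in> \<real>\<^sub>\<ge>\<^sub>0" by (simp add: complex_nonneg_Reals_iff)
  qed
qed

lemma pos_semidef_congruence:
  fixes M P :: "complex^'n^'n"
  assumes "pos_semidef M"
  shows "pos_semidef (P ** M ** conj_transpose P)"
  unfolding pos_semidef_iff_quadratic_form
proof (intro conjI allI)
  show "hermitian (P ** M ** conj_transpose P)"
    using assms by (simp add: pos_semidef_def hermitian_def conj_transpose_mult matrix_mul_assoc)
  fix v
  have "inner v ((P ** M ** conj_transpose P) *v v)
      = inner (conj_transpose P *v v) (M *v (conj_transpose P *v v))"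
    by (simp add: inner_matrix_vector matrix_vector_mul_assoc matrix_mul_assoc)
  then show "0 \<le> inner v ((P ** M ** conj_transpose P) *v v)"
    using assms by (simp add: pos_semidef_iff_quadratic_form)
qed

lemma pos_semidef_scaleR:
  assumes "pos_semidef M" "r \<ge> 0"
  shows "pos_semidef (r *\<^sub>R M)"
  using assms
  by (simp add: pos_semidef_iff_quadratic_form hermitian_def conj_transpose_linear_simps
      scaleR_matrix_mult_vector)

section \<open>The word sums\<close>

lemma finite_words: "finite {w :: bool list. length w = m \<and> count_list w True = k}"
  by (rule finite_subset[OF _ finite_lists_length_eq[of UNIV m]]) auto

lemma word_val_Nil [simp]: "word_val A B [] = mat 1"
  and word_val_Cons [simp]: "word_val A B (b # w) = (if b then B else A) ** word_val A B w"
  by (simp_all add: word_val_def)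

lemma word_val_append: "word_val A B (u @ w) = word_val A B u ** word_val A B w"
  by (induction u) (auto simp: matrix_mul_assoc)

lemma S_0: "S 0 k A B = (if k = 0 then mat 1 else 0)"
proof -
  have "{w :: bool list. length w = 0 \<and> count_list w True = k} = (if k = 0 then {[]} else {})"
    by auto
  then show ?thesis by (simp add: S_def)
qed

text \<open>Words are split by their first letter; the truncated $k - 1$ is guarded because
  no word with zero letters $B$ starts with $B$.\<close>

lemma S_Suc:
  "S (Suc m) k A B = A ** S m k A B + (if k = 0 then 0 else B ** S m (k - 1) A B)"
proof -
  let ?W = "\<lambda>m k. {w :: bool list. length w = m \<and> count_list w True = k}"
  have split: "?W (Suc m) k = (#) False ` ?W m k \<union> (#) True ` (if k = 0 then {} else ?W m (k - 1))"
    by (auto simp: length_Suc_conv image_iff split: if_splits)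
  have "S (Suc m) k A B = (\<Sum>w\<in>(#) False ` ?W m k. word_val A B w)
      + (\<Sum>w\<in>(#) True ` (if k = 0 then {} else ?W m (k - 1)). word_val A B w)"
    unfolding S_def split by (rule sum.union_disjoint) (auto simp: finite_words)
  also have "\<dots> = A ** S m k A B + (if k = 0 then 0 else B ** S m (k - 1) A B)"
    by (simp add: S_def sum.reindex matmul.sum_right)
  finally show ?thesis .
qed

lemma S_eq_0: "m < k \<Longrightarrow> S m k A B = 0"
  by (induction m arbitrary: k) (auto simp: S_0 S_Suc)

lemma S_scaleR_left:
  "k \<le> m \<Longrightarrow> S m k (r *\<^sub>R A) B = r ^ (m - k) *\<^sub>R S m k A B"
proof (induction m arbitrary: k)
  case (Suc m)
  show ?case
  proof (cases "k = Suc m")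
    case True
    then show ?thesis using Suc.IH[of m] by (simp add: S_Suc S_eq_0)
  next
    case False
    with Suc.prems have "k \<le> m" by simp
    then show ?thesis
      using Suc.IH[of k] Suc.IH[of "k - 1"]
      by (auto simp: S_Suc matmul.scaleR_left matmul.scaleR_right scaleR_add_right Suc_diff_le
          split: nat.split)
  qed
qed (simp add: S_0)

lemma S_swap:
  assumes "k \<le> m"
  shows "S m k A B = S m (m - k) B A"
proof -
  have val: "word_val B A (map Not w) = word_val A B w" for w
    by (induction w) auto
  have count: "count_list (map Not w) True + count_list w True = length w" for w
    by (induction w) auto
  show ?thesis unfolding S_def
  proof (rule sum.reindex_bij_witness[of _ "map Not" "map Not"])
    fix w :: "bool list" assume "w \<in> {w. length w = m \<and> count_list w True = k}"
    then show "map Not w \<in> {w. length w = m \<and> count_list w True = m - k}"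
      using count[of w] by auto
  next
    fix w :: "bool list" assume "w \<in> {w. length w = m \<and> count_list w True = m - k}"
    then show "map Not w \<in> {w. length w = m \<and> count_list w True = k}"
      using count[of w] assms by auto
  qed (auto simp: val comp_def)
qed

text \<open>Conjugate transposition reverses each word and so permutes the summands.\<close>

lemma hermitian_S:
  assumes "hermitian A" "hermitian B"
  shows "hermitian (S m k A B)"
proof -
  have val: "conj_transpose (word_val A B w) = word_val A B (rev w)" for w
    using assms by (induction w) (auto simp: word_val_append conj_transpose_mult hermitian_def)
  have count: "count_list (rev w) True = count_list w True" for w
    by (induction w) auto
  show ?thesis
    unfolding hermitian_def S_def conj_transpose_linear_simps val
    by (rule sum.reindex_bij_witness[of _ rev rev]) (auto simp: count)
qed

section \<open>The derivative of the trace of a word sum\<close>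

primrec matpow :: "complex^'n^'n \<Rightarrow> nat \<Rightarrow> complex^'n^'n" where
  "matpow M 0 = mat 1"
| "matpow M (Suc m) = M ** matpow M m"

lemma matpow_add: "matpow M (i + j) = matpow M i ** matpow M j"
  by (induction i) (auto simp: matrix_mul_assoc)

lemma matpow_Suc_right: "matpow M (Suc m) = matpow M m ** M"
  using matpow_add[of M m 1] by simp

lemma matpow_binomial: "matpow (A + s *\<^sub>R B) m = (\<Sum>k\<le>m. s ^ k *\<^sub>R S m k A B)"
proof (induction m)
  case (Suc m)
  have "matpow (A + s *\<^sub>R B) (Suc m)
      = (\<Sum>k\<le>m. s ^ k *\<^sub>R (A ** S m k A B)) + (\<Sum>k\<le>m. s ^ Suc k *\<^sub>R (B ** S m k A B))"
    by (simp add: Suc.IH matmul.add_left matmul.sum_right matmul.scaleR_left matmul.scaleR_right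
        scaleR_add_right sum.distrib mult.commute)
  also have "(\<Sum>k\<le>m. s ^ k *\<^sub>R (A ** S m k A B)) = (\<Sum>k\<le>Suc m. s ^ k *\<^sub>R (A ** S m k A B))"
    by (simp add: S_eq_0)
  also have "(\<Sum>k\<le>m. s ^ Suc k *\<^sub>R (B ** S m k A B))
      = (\<Sum>k\<le>Suc m. s ^ k *\<^sub>R (if k = 0 then 0 else B ** S m (k - 1) A B))"
    unfolding sum.atMost_Suc_shift by simp
  finally show ?case
    by (simp add: S_Suc scaleR_add_right sum.distrib del: sum.atMost_Suc)
qed (simp add: S_0)

text \<open>The derivative $E$ of $M^m$ is a sum of terms $M^i D M^{m-1-i}$, which all
  have the same trace after a cyclic rotation. The extra factor $M^j$ is what makes the induction
  on $m$ go through, since the product rule produces $M E$; only $j = 0$ is of interest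
  afterwards. For $m = 0$ the truncated exponent is harmless because of the factor $m$.\<close>

lemma matpow_has_vector_derivative:
  assumes F: "(F has_vector_derivative D) (at t)"
  shows "\<exists>E. ((\<lambda>t. matpow (F t) m) has_vector_derivative E) (at t) \<and>
    (\<forall>j. trace (matpow (F t) j ** E) = of_nat m * trace (D ** matpow (F t) (j + m - 1)))"
proof (induction m)
  case 0
  show ?case by (rule exI[of _ 0]) (simp add: trace_def)
next
  case (Suc m)
  then obtain E where E: "((\<lambda>t. matpow (F t) m) has_vector_derivative E) (at t)"
    and tr: "\<And>j. trace (matpow (F t) j ** E) = of_nat m * trace (D ** matpow (F t) (j + m - 1))"
    by blast
  let ?M = "F t"
  have "trace (matpow ?M j ** (?M ** E + D ** matpow ?M m))
      = of_nat (Suc m) * trace (D ** matpow ?M (j + m))" for j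
  proof -
    have "trace (matpow ?M j ** (?M ** E)) = of_nat m * trace (D ** matpow ?M (j + m))"
      using tr[of "Suc j"] by (simp add: matpow_Suc_right matrix_mul_assoc del: matpow.simps)
    moreover have "trace (matpow ?M j ** (D ** matpow ?M m)) = trace (D ** matpow ?M (j + m))"
      by (subst trace_mul_sym) (simp add: add.commute[of j] matpow_add matrix_mul_assoc)
    ultimately show ?thesis
      by (simp add: matmul.add_right trace_add algebra_simps)
  qed
  then show ?case
    using matmul.has_vector_derivative[OF F E] by auto
qed

lemma S_has_vector_derivative:
  assumes F: "(F has_vector_derivative D) (at t)"
  shows "\<exists>E. ((\<lambda>t. S m k (F t) B) has_vector_derivative E) (at t)"
proof (induction m arbitrary: k)
  case (Suc m)
  obtain E E' where "((\<lambda>t. S m k (F t) B) has_vector_derivative E) (at t)"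
    and E': "((\<lambda>t. S m (k - 1) (F t) B) has_vector_derivative E') (at t)"
    using Suc by blast
  note E = matmul.has_vector_derivative[OF F this(1)]
  note B = bounded_linear.has_vector_derivative[OF matmul.bounded_linear_right E', of B]
  show ?case
    using E has_vector_derivative_add[OF E B]
    by (cases "k = 0") (auto simp: S_Suc)
qed (auto simp: S_0 intro: has_vector_derivative_const)

text \<open>Differentiating $(F(t) + sB)^m$ once through its expansion in powers of
  $s$ and once as a power gives two polynomials in $s$ that agree for all real $s$; the claim is
  the equality of the coefficients of $s^k$.\<close>

lemma trace_S_has_real_derivative:
  assumes F: "(F has_vector_derivative D) (at t)" and m: "0 < m"
  shows "((\<lambda>t. Re (trace (S m k (F t) B))) has_real_derivative
    real m * Re (trace (D ** S (m - 1) k (F t) B))) (at t)"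
proof (cases "k \<le> m")
  case True
  have "\<forall>k. \<exists>E. ((\<lambda>t. S m k (F t) B) has_vector_derivative E) (at t)"
    by (intro allI S_has_vector_derivative[OF F])
  from choice[OF this] obtain E
    where E: "\<And>k. ((\<lambda>t. S m k (F t) B) has_vector_derivative E k) (at t)"
    by blast
  have "(\<Sum>k\<le>m. Re (trace (E k)) * s ^ k)
      = (\<Sum>k\<le>m. real m * Re (trace (D ** S (m - 1) k (F t) B)) * s ^ k)" for s
  proof -
    have "((\<lambda>t. F t + s *\<^sub>R B) has_vector_derivative D) (at t)"
      using has_vector_derivative_add[OF F has_vector_derivative_const] by simp
    from matpow_has_vector_derivative[OF this, of m] obtain G
      where G: "((\<lambda>t. matpow (F t + s *\<^sub>R B) m) has_vector_derivative G) (at t)"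
        and "\<And>j. trace (matpow (F t + s *\<^sub>R B) j ** G)
          = of_nat m * trace (D ** matpow (F t + s *\<^sub>R B) (j + m - 1))"
      by blast
    from this(2)[of 0] have tr: "trace G = of_nat m * trace (D ** matpow (F t + s *\<^sub>R B) (m - 1))"
      by simp
    have "((\<lambda>t. matpow (F t + s *\<^sub>R B) m) has_vector_derivative (\<Sum>k\<le>m. s ^ k *\<^sub>R E k)) (at t)"
      unfolding matpow_binomial
      by (intro has_vector_derivative_sum
          bounded_linear.has_vector_derivative[OF bounded_linear_scaleR_right] E)
    with G have "G = (\<Sum>k\<le>m. s ^ k *\<^sub>R E k)"
      by (rule vector_derivative_unique_at)
    then have "(\<Sum>k\<le>m. Re (trace (E k)) * s ^ k) = Re (trace G)"
      by (simp add: Re_trace_linear_simps mult.commute)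
    also have "\<dots> = real m * Re (trace (D ** matpow (F t + s *\<^sub>R B) (m - 1)))"
      by (simp add: tr)
    \<comment> \<open>The summation is extended to $k = m$, where the coefficient is zero, so that both
      polynomials have the same range of exponents.\<close>
    also have "matpow (F t + s *\<^sub>R B) (m - 1) = (\<Sum>k\<le>m. s ^ k *\<^sub>R S (m - 1) k (F t) B)"
      using m by (cases m) (simp_all add: matpow_binomial S_eq_0)
    also have "real m * Re (trace (D ** \<dots>))
        = (\<Sum>k\<le>m. real m * Re (trace (D ** S (m - 1) k (F t) B)) * s ^ k)"
      by (simp add: matmul.sum_right matmul.scaleR_right Re_trace_linear_simps sum_distrib_left
          algebra_simps)
    finally show ?thesis .
  qed
  then have "Re (trace (E k)) = real m * Re (trace (D ** S (m - 1) k (F t) B))"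
    using True polyfun_eq_coeffs[of "\<lambda>k. Re (trace (E k))" m
        "\<lambda>k. real m * Re (trace (D ** S (m - 1) k (F t) B))"] by blast
  then show ?thesis
    using bounded_linear.has_vector_derivative[OF bounded_linear_Re_trace E[of k]]
    by (simp add: has_real_derivative_iff_has_vector_derivative)
next
  case False
  then show ?thesis using m by (simp add: S_eq_0 trace_def)
qed

section \<open>The extremal equations\<close>

text \<open>The norm constraint is removed by homogeneity: a nonzero $X$ is rescaled to norm $1$, and
  for $X = 0$ both sides vanish because $m - k > 0$. The sign $\<sigma>$ treats minima
  ($\<sigma> = 1$) and maxima ($\<sigma> = -1$) together.\<close>

lemma extremal_scaled_bound:
  fixes A B X :: "complex^'n^'n"
  assumes "k < m" and "pos_semidef X"
    and ext: "\<And>X. pos_semidef X \<Longrightarrow> mat_norm X = 1 \<Longrightarrow>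
      \<sigma> * Re (trace (S m k A B)) \<le> \<sigma> * Re (trace (S m k X B))"
  shows "\<sigma> * Re (trace (S m k A B)) * norm X ^ (m - k) \<le> \<sigma> * Re (trace (S m k X B))"
proof (cases "X = 0")
  case True
  then have "S m k X B = 0" using S_scaleR_left[of k m 0 X B] \<open>k < m\<close> by (simp add: power_0_left)
  with True show ?thesis using \<open>k < m\<close> by (simp add: trace_def power_0_left)
next
  case False
  define Y where "Y = X /\<^sub>R norm X"
  have "pos_semidef Y" "mat_norm Y = 1"
    using False assms by (auto simp: Y_def mat_norm_eq_norm intro: pos_semidef_scaleR)
  from ext[OF this] have "\<sigma> * Re (trace (S m k A B)) * norm X ^ (m - k)
      \<le> \<sigma> * Re (trace (S m k Y B)) * norm X ^ (m - k)"
    by (intro mult_right_mono) auto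
  also have "X = norm X *\<^sub>R Y" using False by (simp add: Y_def)
  then have "S m k X B = norm X ^ (m - k) *\<^sub>R S m k Y B"
    using S_scaleR_left[of k m "norm X" Y B] \<open>k < m\<close> by simp
  then have "\<sigma> * Re (trace (S m k Y B)) * norm X ^ (m - k) = \<sigma> * Re (trace (S m k X B))"
    by (simp add: Re_trace_linear_simps)
  finally show ?thesis .
qed

lemma norm_has_real_derivative:
  fixes F :: "real \<Rightarrow> 'a::real_inner"
  assumes F: "(F has_vector_derivative D) (at t)" and 1: "norm (F t) = 1"
  shows "((\<lambda>t. norm (F t)) has_real_derivative inner (F t) D) (at t)"
proof -
  have "F t \<noteq> 0" using 1 by auto
  from has_derivative_compose[OF F[unfolded has_vector_derivative_def] has_derivative_norm[OF this]]
  show ?thesis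
    using 1 by (simp add: has_field_derivative_def sgn_div_norm inner_commute mult.commute[of _ "inner _ _"])
qed

text \<open>First-order stationarity along the congruences
  $(1 + tH) A (1 + tH)^*$. Only the first argument varies, so this applies to either matrix of an
  extremal pair once the letters are exchanged.\<close>

lemma extremal_first_factor:
  fixes A B :: "complex^'n^'n"
  assumes "k < m" and A: "pos_semidef A" "mat_norm A = 1" and B: "pos_semidef B"
    and \<sigma>: "\<sigma> \<noteq> 0"
    and ext: "\<And>X. pos_semidef X \<Longrightarrow> mat_norm X = 1 \<Longrightarrow>
      \<sigma> * Re (trace (S m k A B)) \<le> \<sigma> * Re (trace (S m k X B))"
  shows "A ** S (m - 1) k A B = mat_scale (trace (A ** S (m - 1) k A B)) (A ** A)"
proof -
  have hA: "conj_transpose A = A" and hB: "conj_transpose B = B"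
    using A B by (simp_all add: pos_semidef_def hermitian_def)
  have nA: "norm A = 1" using A by (simp add: mat_norm_eq_norm)
  define f where "f = Re (trace (S m k A B))"
  define T where "T = S (m - 1) k A B"
  have hT: "conj_transpose T = T"
    using hermitian_S[of A B "m - 1" k] hA hB by (simp add: T_def hermitian_def)
  \<comment> \<open>The Lagrange multiplier of the norm constraint divided by $m$; by Euler's identity it is the trace in the
    conclusion, but here that is recovered at the end from $\mathrm{Tr}\,A^2 = 1$.\<close>
  define c where "c = real (m - k) * f / real m"
  define W where "W = T - c *\<^sub>R A"
  have hW: "conj_transpose W = W"
    by (simp add: W_def conj_transpose_linear_simps hT hA)
  \<comment> \<open>Stationarity in direction $H$ reads $\langle H, WA\rangle = 0$; this $H$ makes the left side
    a squared norm.\<close>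
  define H where "H = W ** A"
  define D where "D = H ** A + A ** conj_transpose H"
  define P where "P t = mat 1 + t *\<^sub>R H" for t
  define F where "F t = P t ** A ** conj_transpose (P t)" for t
  have psd: "pos_semidef (F t)" for t
    unfolding F_def using A(1) by (rule pos_semidef_congruence)
  have F_expand: "F t = A + t *\<^sub>R D + t\<^sup>2 *\<^sub>R (H ** A ** conj_transpose H)" for t
    by (simp add: F_def P_def D_def conj_transpose_linear_simps matmul.add_left matmul.add_right
        matmul.scaleR_left matmul.scaleR_right scaleR_add_right power2_eq_square)
  have F0: "F 0 = A" by (simp add: F_expand)
  have F': "(F has_vector_derivative D) (at 0)"
    unfolding F_expand[abs_def]
    by (auto intro!: derivative_eq_intros)
  define h where
    "h t = \<sigma> * Re (trace (S m k (F t) B)) - \<sigma> * f * norm (F t) ^ (m - k)" for t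
  have "(h has_real_derivative \<sigma> * (real m * Re (trace (D ** T)))
      - \<sigma> * f * (real (m - k) * inner A D)) (at 0)"
    unfolding h_def[abs_def]
    using trace_S_has_real_derivative[OF F', of m k B]
      DERIV_power[OF norm_has_real_derivative[OF F'], of "m - k"] nA \<open>k < m\<close>
    by (intro DERIV_diff DERIV_cmult) (simp_all add: F0 T_def)
  moreover have "h 0 \<le> h t" for t
    using extremal_scaled_bound[OF \<open>k < m\<close> psd[of t] ext] nA
    by (simp add: h_def F0 f_def)
  ultimately have "\<sigma> * (real m * Re (trace (D ** T))) - \<sigma> * f * (real (m - k) * inner A D) = 0"
    by (intro DERIV_local_min[OF _ zero_less_one]) auto
  then have "real m * Re (trace (D ** T)) = real (m - k) * f * inner A D"
    using \<sigma> by simp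
  moreover have "Re (trace (D ** T)) = inner D T"
    by (simp add: inner_matrix_eq_trace hT)
  ultimately have "inner D W = 0"
    using \<open>k < m\<close> by (simp add: W_def c_def inner_diff_right inner_commute field_simps)
  moreover have "inner (A ** conj_transpose H) W = inner (H ** A) W"
    using inner_conj_transpose[of "H ** A" W] by (simp add: conj_transpose_mult hA hW)
  ultimately have "inner (H ** A) W = 0"
    by (simp add: D_def inner_add_left)
  then have "inner H H = 0" by (simp add: inner_mult_left_matrix hA H_def)
  then have "W ** A = 0" by (simp add: H_def)
  from arg_cong[OF this, of conj_transpose] have "A ** W = 0"
    by (simp add: conj_transpose_mult hA hW conj_transpose_linear_simps)
  then have eq: "A ** T = c *\<^sub>R (A ** A)"
    by (simp add: W_def matmul.diff_right matmul.scaleR_right)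
  have "trace (A ** A) = 1"
  proof (rule complex_eqI)
    have "cnj (trace (A ** A)) = trace (conj_transpose (A ** A))"
      by (simp add: trace_def conj_transpose_def)
    then show "Im (trace (A ** A)) = Im 1"
      by (simp add: conj_transpose_mult hA complex_eq_iff)
    show "Re (trace (A ** A)) = Re 1"
      using inner_matrix_eq_trace[of A A] nA by (simp add: hA norm_eq_sqrt_inner)
  qed
  moreover have "trace (c *\<^sub>R (A ** A)) = of_real c * trace (A ** A)"
    unfolding trace_def by (simp add: scaleR_conv_of_real[where 'a=complex] sum_distrib_left)
  ultimately show ?thesis
    unfolding T_def[symmetric] eq
    by (simp add: mat_scale_def vec_eq_iff scaleR_conv_of_real[where 'a=complex])
qed

theorem theorem1p3:
  fixes A B :: "complex^'n^'n" and m k :: nat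
  assumes "0 < k" and "k < m"
    and "is_arg_min (trace_S m k) feasible (A, B) \<or> is_arg_max (trace_S m k) feasible (A, B)"
  shows "A ** S (m - 1) k A B = mat_scale (trace (A ** S (m - 1) k A B)) (A ** A) \<and>
         B ** S (m - 1) (k - 1) A B = mat_scale (trace (B ** S (m - 1) (k - 1) A B)) (B ** B)"
proof -
  have "feasible (A, B)"
    using assms(3) unfolding is_arg_min_def is_arg_max_def by blast
  then have A: "pos_semidef A" "mat_norm A = 1" and B: "pos_semidef B" "mat_norm B = 1"
    by (simp_all add: feasible_def)
  obtain \<sigma> :: real where \<sigma>: "\<sigma> \<noteq> 0"
    and ext: "\<And>X Y :: complex^'n^'n. feasible (X, Y) \<Longrightarrow> \<sigma> * trace_S m k (A, B) \<le> \<sigma> * trace_S m k (X, Y)"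
    using assms(3)
  proof
    assume "is_arg_min (trace_S m k) feasible (A, B)"
    then show thesis by (intro that[of 1]) (auto simp: is_arg_min_def not_less)
  next
    assume "is_arg_max (trace_S m k) feasible (A, B)"
    then show thesis by (intro that[of "-1"]) (auto simp: is_arg_max_def not_less)
  qed
  have "A ** S (m - 1) k A B = mat_scale (trace (A ** S (m - 1) k A B)) (A ** A)"
  proof (rule extremal_first_factor[OF \<open>k < m\<close> A B(1) \<sigma>])
    fix X :: "complex^'n^'n" assume "pos_semidef X" "mat_norm X = 1"
    then show "\<sigma> * Re (trace (S m k A B)) \<le> \<sigma> * Re (trace (S m k X B))"
      using ext[of X B] B by (simp add: feasible_def trace_S_def)
  qed
  moreover have "B ** S (m - 1) (m - k) B A
      = mat_scale (trace (B ** S (m - 1) (m - k) B A)) (B ** B)"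
  proof (rule extremal_first_factor[OF _ B A(1) \<sigma>])
    show "m - k < m" using assms(1,2) by simp
    fix X :: "complex^'n^'n" assume "pos_semidef X" "mat_norm X = 1"
    then have "\<sigma> * Re (trace (S m k A B)) \<le> \<sigma> * Re (trace (S m k A X))"
      using ext[of A X] A by (simp add: feasible_def trace_S_def)
    then show "\<sigma> * Re (trace (S m (m - k) B A)) \<le> \<sigma> * Re (trace (S m (m - k) X A))"
      using S_swap[of k m A] \<open>k < m\<close> by simp
  qed
  moreover have "S (m - 1) (m - k) B A = S (m - 1) (k - 1) A B"
    using S_swap[of "k - 1" "m - 1" A B] assms(1,2) by simp
  ultimately show ?thesis by simp
qed

end
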